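(* In the setting described in the context, if $(k_n-\mathbb{E}(\Sigma_n))/\sqrt n\to K$ for some $K\in[-\infty,\infty)$, then the conditional laws $\mathcal{L}(\mathcal{X}^p_n\mid\Sigma_n\ge k_n)$ converge weakly, as $n\to\infty$, to the probability measure on $\mathbb{R}^M$ which has density $h\mathbf{1}_{H_K}/\int h\mathbf{1}_{H_K}\,d\lambda$ with respect to $M$-dimensional Lebesgue measure $\lambda$.
   Context: Setting. Fix an integer $M\ge1$, numbers $\alpha_1,\dots,\alpha_M\in(0,1)$ with $\sum_{i=1}^M\alpha_i=1$, a number $\alpha\in(0,1)$, and probabilities $p_1,\dots,p_M\in(0,1)$. For every $n\ge1$, nonnegative integers $m_{1n},\dots,m_{Mn}$ (block sizes) with $\sum_i m_{in}=n$ are given, with $m_{in}/n\to\alpha_i$; also integers $0\le k_n\le n$ are given with $k_n/n\to\alpha$. For each $n$, $X_{1n},\dots,X_{Mn}$ are independent, $X_{in}$ being binomial with parameters $m_{in}$ and $p_i$ (the number of successes in block $i$ of a vector of $n$ independent Bernoulli variables, those in block $i$ having success probability $p_i$). Put $\Sigma_n:=\sum_{i=1}^M X_{in}$, so $\mathbb{E}(\Sigma_n)=\sum_i p_i m_{in}$, and $$\mathcal{X}^p_n:=\Bigl(\frac{X_{1n}-p_1m_{1n}}{\sqrt n},\dots,\frac{X_{Mn}-p_Mm_{Mn}}{\sqrt n}\Bigr).$$ Let $h(z)=\prod_{i=1}^M\exp\bigl(-\frac{z_i^2}{2p_i(1-p_i)\alpha_i}\bigr)$ for $z\in\mathbb{R}^M$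 and $H_K:=\{z\in\mathbb{R}^M: z_1+\dots+z_M\ge K\}$ (so $H_{-\infty}=\mathbb{R}^M$). *)

theory Defs
  imports "HOL-Probability.Probability"
begin

text \<open>
  Weak convergence is defined in the library only for measures on the real line (via distribution
  functions); on a general topological space we use bounded continuous test functions.
\<close>

definition weakly_converges ::
    "(nat \<Rightarrow> 'a::topological_space measure) \<Rightarrow> 'a measure \<Rightarrow> bool" where
  "weakly_converges \<mu> \<nu> \<longleftrightarrow>
     (\<forall>f::'a \<Rightarrow> real. continuous_on UNIV f \<and> bounded (range f) \<longrightarrow>
        (\<lambda>n. integral\<^sup>L (\<mu> n) f) \<longlonglongrightarrow> integral\<^sup>L \<nu> f)"

text \<open>
  The conditional law of \<open>Y\<close> given the event \<open>A\<close>; \<open>uniform_measure \<Omega> A\<close> is the measure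
  \<open>B \<mapsto> P(A \<inter> B) / P(A)\<close>, so this is meaningful only for events of positive probability.
\<close>

definition cond_law :: "'w measure \<Rightarrow> 'w set \<Rightarrow> ('w \<Rightarrow> 'a::topological_space) \<Rightarrow> 'a measure" where
  "cond_law \<Omega> A Y = distr (uniform_measure \<Omega> A) borel Y"

definition centred_scaled ::
    "nat \<Rightarrow> ('m::finite \<Rightarrow> real) \<Rightarrow> ('m \<Rightarrow> nat) \<Rightarrow> ('m \<Rightarrow> nat) \<Rightarrow> real ^ 'm" where
  "centred_scaled n p m x = (\<chi> i. (real (x i) - p i * real (m i)) / sqrt (real n))"

definition h :: "('m::finite \<Rightarrow> real) \<Rightarrow> ('m \<Rightarrow> real) \<Rightarrow> real ^ 'm \<Rightarrow> real" where
  "h p \<alpha> z = (\<Prod>i\<in>UNIV. exp (- ((z $ i)\<^sup>2 / (2 * p i * (1 - p i) * \<alpha> i))))"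

text \<open>The threshold is extended real, so that \<open>H (-\<infinity>)\<close> is the whole space.\<close>

definition H :: "ereal \<Rightarrow> (real ^ 'm::finite) set" where
  "H K = {z. K \<le> ereal (\<Sum>i\<in>UNIV. z $ i)}"

definition limit_law :: "('m::finite \<Rightarrow> real) \<Rightarrow> ('m \<Rightarrow> real) \<Rightarrow> ereal \<Rightarrow> (real ^ 'm) measure" where
  "limit_law p \<alpha> K =
     density lborel
       (\<lambda>z. ennreal (h p \<alpha> z * indicator (H K) z / (LINT y|lborel. h p \<alpha> y * indicator (H K) y)))"

end

theory Submission
  imports Defs
begin

text \<open>
  By the central limit theorem each centred and scaled block count converges in law to a centred
  normal variable. Skorohod's theorem turns this into pointwise convergence, separately in every
  block; on the product of the Skorohod spaces the coordinates are independent, so the whole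
  vector is realised with its correct law and converges pointwise. Hyperplanes are null sets for
  the Gaussian limit, so the indicator of the conditioning event converges almost surely, and
  dominated convergence applies to the numerator and the denominator of the conditional
  expectation.
\<close>

text \<open>Convergence in law of the scaled vector does not settle the claim by itself: the test
  function is multiplied by the indicator of an event, which is discontinuous and whose threshold
  moves with n. Dividing by sqrt n turns the event into the half-space on which the coordinate sum
  is at least (k_n - E Sigma_n) / sqrt n, so the hypothesis on k_n says exactly that this threshold
  tends to K; working in the extended reals treats K = -\<infinity> like any other value. Two
  normalisations have to be reconciled. The central limit theorem divides the count of block i by
  its own standard deviation, the scaled vector divides by sqrt n; the quotient of the two scales
  tends to sqrt (\<alpha> i * p i * (1 - p i)), which is where the variances in \<open>h\<close>
  come from. The function \<open>h\<close> itself is unnormalised, but its missing constant occurs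
  in numerator and denominator alike and cancels. Finally, K < \<infinity> gives \<open>H K\<close>
  positive mass, so the denominator has a nonzero limit; the same fact gives the conditioning events
  positive probability for all large n.\<close>

section \<open>Independence and the normal approximation of binomial counts\<close>

lemma indep_vars_PiM_components:
  fixes M :: "'i \<Rightarrow> 'b measure"
  assumes "\<And>i. i \<in> I \<Longrightarrow> prob_space (M i)"
  shows "prob_space.indep_vars (PiM I M) M (\<lambda>i \<omega>. \<omega> i) I"
proof (cases "I = {}")
  case True
  interpret P: prob_space "PiM I M" using assms by (rule prob_space_PiM)
  show ?thesis unfolding P.indep_vars_def P.indep_sets_def using True by simp
next
  case False
  interpret P: prob_space "PiM I M" using assms by (rule prob_space_PiM)
  \<comment> \<open>Points of the product space are already restricted to \<open>I\<close>, so the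
    joint law of the coordinates is the product measure itself. The characterisation of independence
    used below asks for a nonempty index set, hence the case split.\<close>
  have "distr (PiM I M) (PiM I M) (\<lambda>\<omega>. \<lambda>i\<in>I. \<omega> i) = distr (PiM I M) (PiM I M) (\<lambda>\<omega>. \<omega>)"
    by (intro distr_cong) (auto simp: space_PiM)
  moreover have "PiM I (\<lambda>i. distr (PiM I M) (M i) (\<lambda>\<omega>. \<omega> i)) = PiM I M"
    by (intro PiM_cong refl distr_PiM_component assms) auto
  ultimately show ?thesis
    using False by (subst P.indep_vars_iff_distr_eq_PiM') auto
qed

text \<open>The characteristic function of an independent sum is the product of the individual ones,
  hence determined by the marginals. The two families may live on different spaces, which allows
  coins to be exchanged between a finite and an infinite product.\<close>

lemma distr_sum_eqI_indep_vars:
  fixes X :: "'i \<Rightarrow> 'a \<Rightarrow> real" and Y :: "'i \<Rightarrow> 'b \<Rightarrow> real"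
  assumes M: "prob_space M" "prob_space.indep_vars M (\<lambda>_. borel) X A"
    and N: "prob_space N" "prob_space.indep_vars N (\<lambda>_. borel) Y A"
    and eq: "\<And>i. i \<in> A \<Longrightarrow> distr M borel (X i) = distr N borel (Y i)"
  shows "distr M borel (\<lambda>\<omega>. \<Sum>i\<in>A. X i \<omega>) = distr N borel (\<lambda>\<omega>. \<Sum>i\<in>A. Y i \<omega>)"
proof (rule Levy_uniqueness)
  interpret M: prob_space M by fact
  interpret N: prob_space N by fact
  have [measurable]: "i \<in> A \<Longrightarrow> X i \<in> borel_measurable M" "i \<in> A \<Longrightarrow> Y i \<in> borel_measurable N" for i
    using M(2) N(2) by (auto simp: M.indep_vars_def N.indep_vars_def)
  show "real_distribution (distr M borel (\<lambda>\<omega>. \<Sum>i\<in>A. X i \<omega>))"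
    by (rule M.real_distribution_distr) measurable
  show "real_distribution (distr N borel (\<lambda>\<omega>. \<Sum>i\<in>A. Y i \<omega>))"
    by (rule N.real_distribution_distr) measurable
  show "char (distr M borel (\<lambda>\<omega>. \<Sum>i\<in>A. X i \<omega>)) = char (distr N borel (\<lambda>\<omega>. \<Sum>i\<in>A. Y i \<omega>))"
    using eq by (intro ext) (simp add: M.char_distr_sum[OF M(2)] N.char_distr_sum[OF N(2)])
qed

text \<open>A binomial law counts successes in a finite product depending on \<open>n\<close>,
  whereas the central limit theorem wants one sequence \<open>B\<close> serving all
  \<open>n\<close>. Equality of laws of independent sums bridges the two.\<close>

lemma distr_binomial_pmf_eq_distr_sum_bernoulli:
  fixes M :: "'a measure" and B :: "nat \<Rightarrow> 'a \<Rightarrow> bool"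
  assumes p: "p \<in> {0..1}"
    and M: "prob_space M" "prob_space.indep_vars M (\<lambda>_. count_space UNIV) B UNIV"
    and B: "\<And>i. distr M (count_space UNIV) (B i) = measure_pmf (bernoulli_pmf p)"
  shows "distr (binomial_pmf n p) borel real = distr M borel (\<lambda>\<omega>. \<Sum>i<n. of_bool (B i \<omega>))"
proof -
  interpret M: prob_space M by fact
  let ?C = "Pi_pmf {..<n} False (\<lambda>_. bernoulli_pmf p)"
  have [measurable]: "B i \<in> measurable M (count_space UNIV)" for i
    using M(2) by (auto simp: M.indep_vars_def)
  have "distr (binomial_pmf n p) borel real = distr ?C borel (\<lambda>f. real (card {i\<in>{..<n}. f i}))"
    unfolding binomial_pmf_altdef'[OF finite_lessThan card_lessThan p, of n False]
    by (simp add: map_pmf_rep_eq distr_distr o_def)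
  also have "(\<lambda>f. real (card {i\<in>{..<n}. f i})) = (\<lambda>f. \<Sum>i<n. of_bool (f i))"
    by (auto simp: sum_of_bool_eq intro!: arg_cong[where f = card])
  also have "distr ?C borel (\<lambda>f. \<Sum>i<n. of_bool (f i) :: real) = distr M borel (\<lambda>\<omega>. \<Sum>i<n. of_bool (B i \<omega>))"
  proof (rule distr_sum_eqI_indep_vars)
    show "prob_space.indep_vars ?C (\<lambda>_. borel) (\<lambda>i f. of_bool (f i) :: real) {..<n}"
      by (intro prob_space.indep_vars_compose2[OF _ indep_vars_Pi_pmf])
        (auto simp: measure_pmf.prob_space_axioms)
    show "M.indep_vars (\<lambda>_. borel) (\<lambda>i \<omega>. of_bool (B i \<omega>) :: real) {..<n}"
      by (intro M.indep_vars_compose2[OF M.indep_vars_subset[OF M(2)]]) auto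
    fix i assume i: "i \<in> {..<n}"
    have "distr ?C borel (\<lambda>f. of_bool (f i) :: real) =
        distr (map_pmf (\<lambda>f. f i) ?C) borel of_bool"
      by (simp add: map_pmf_rep_eq distr_distr o_def)
    also have "map_pmf (\<lambda>f. f i) ?C = bernoulli_pmf p"
      using i by (simp add: Pi_pmf_component)
    also have "distr (bernoulli_pmf p) borel of_bool = distr M borel (\<lambda>\<omega>. of_bool (B i \<omega>) :: real)"
      by (subst B[of i, symmetric], subst distr_distr) (auto simp: o_def)
    finally show "distr ?C borel (\<lambda>f. of_bool (f i) :: real) = distr M borel (\<lambda>\<omega>. of_bool (B i \<omega>))" .
  qed (auto simp: measure_pmf.prob_space_axioms M)
  finally show ?thesis .
qed

text \<open>The centred sum of the first n coins is an affine image of the number of successes, so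
  the central limit theorem for a single infinite coin sequence speaks about all these binomial
  laws.\<close>

lemma de_Moivre_Laplace:
  assumes p: "0 < p" "p < 1"
  shows "weak_conv_m
    (\<lambda>n. distr (binomial_pmf n p) borel (\<lambda>x. (real x - p * real n) / sqrt (real n * (p * (1 - p)))))
    std_normal_distribution"
proof -
  define M where "M = PiM (UNIV :: nat set) (\<lambda>_. measure_pmf (bernoulli_pmf p))"
  interpret M: prob_space M
    unfolding M_def by (intro prob_space_PiM measure_pmf.prob_space_axioms)
  have ind: "M.indep_vars (\<lambda>_. measure_pmf (bernoulli_pmf p)) (\<lambda>i \<omega>. \<omega> i) UNIV"
    unfolding M_def by (rule indep_vars_PiM_components) (rule measure_pmf.prob_space_axioms)
  then have indB: "M.indep_vars (\<lambda>_. count_space UNIV) (\<lambda>i \<omega>. \<omega> i) UNIV"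
    by (rule M.indep_vars_compose2) auto
  have rv[measurable]: "(\<lambda>\<omega>. \<omega> i) \<in> measurable M (count_space UNIV)" for i
    using indB by (auto simp: M.indep_vars_def)
  have B: "distr M (count_space UNIV) (\<lambda>\<omega>. \<omega> i) = measure_pmf (bernoulli_pmf p)" for i
  proof -
    have "distr M (count_space UNIV) (\<lambda>\<omega>. \<omega> i) = distr M (measure_pmf (bernoulli_pmf p)) (\<lambda>\<omega>. \<omega> i)"
      by (intro distr_cong) auto
    then show ?thesis
      unfolding M_def by (subst (asm) distr_PiM_component) (auto simp: measure_pmf.prob_space_axioms)
  qed
  let ?X = "\<lambda>i \<omega>. of_bool (\<omega> i) :: real"
  have D: "distr M borel (\<lambda>\<omega>. g (\<omega> i)) = distr (bernoulli_pmf p) borel g" for i and g :: "bool \<Rightarrow> real"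
    by (subst B[of i, symmetric], subst distr_distr) (auto simp: o_def)
  have E: "M.expectation (\<lambda>\<omega>. g (\<omega> i)) = measure_pmf.expectation (bernoulli_pmf p) g"
    for i and g :: "bool \<Rightarrow> real"
    by (subst B[of i, symmetric], subst integral_distr) auto
  have "weak_conv_m (\<lambda>n. distr M borel (\<lambda>\<omega>. (\<Sum>i<n. ?X i \<omega> - p) / sqrt (real n * (sqrt (p * (1 - p)))\<^sup>2)))
    std_normal_distribution"
  proof (rule M.central_limit_theorem)
    show "M.indep_vars (\<lambda>_. borel) ?X UNIV"
      by (rule M.indep_vars_compose2[OF indB]) auto
    show "M.expectation (?X i) = p" for i
      using p E[of of_bool i] by simp
    show "M.variance (?X i) = (sqrt (p * (1 - p)))\<^sup>2" for i
      using p E[of of_bool i] E[of "\<lambda>b. (of_bool b - p)\<^sup>2" i]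
      by (simp add: power2_eq_square algebra_simps)
    show "integrable M (\<lambda>\<omega>. (?X i \<omega>)\<^sup>2)" for i
      by (rule M.integrable_const_bound[of _ 1]) auto
    show "distr M borel (?X i) = distr (bernoulli_pmf p) borel of_bool" for i
      by (rule D[of of_bool i])
    show "0 < sqrt (p * (1 - p))" using p by simp
  qed
  moreover have "distr M borel (\<lambda>\<omega>. (\<Sum>i<n. ?X i \<omega> - p) / sqrt (real n * (sqrt (p * (1 - p)))\<^sup>2)) =
      distr (binomial_pmf n p) borel (\<lambda>x. (real x - p * real n) / sqrt (real n * (p * (1 - p))))" for n
  proof -
    let ?g = "\<lambda>x. (x - p * real n) / sqrt (real n * (p * (1 - p)))"
    have "distr (binomial_pmf n p) borel (\<lambda>x. ?g (real x)) =
        distr (distr (binomial_pmf n p) borel real) borel ?g"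
      by (simp add: distr_distr o_def)
    also have "distr (binomial_pmf n p) borel real = distr M borel (\<lambda>\<omega>. \<Sum>i<n. ?X i \<omega>)"
      using p by (intro distr_binomial_pmf_eq_distr_sum_bernoulli[OF _ M.prob_space_axioms indB B]) auto
    also have "distr (distr M borel (\<lambda>\<omega>. \<Sum>i<n. ?X i \<omega>)) borel ?g =
        distr M borel (\<lambda>\<omega>. ?g (\<Sum>i<n. ?X i \<omega>))"
      by (simp add: distr_distr o_def)
    finally show ?thesis
      using p by (simp add: sum_subtractf mult.commute)
  qed
  ultimately show ?thesis by simp
qed

section \<open>Laws of random vectors with independent coordinates\<close>

lemma borel_measurable_vec_lambda:
  fixes f :: "'m::finite \<Rightarrow> 'a \<Rightarrow> real"
  assumes "\<And>i. f i \<in> borel_measurable M"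
  shows "(\<lambda>x. \<chi> i. f i x) \<in> borel_measurable M"
  using assms by (subst borel_measurable_euclidean_space) (auto simp: Basis_vec_def inner_axis)

lemma nn_integral_lborel_prod_vec:
  fixes f :: "'m::finite \<Rightarrow> real \<Rightarrow> ennreal"
  assumes "\<And>i. f i \<in> borel_measurable borel"
  shows "(\<integral>\<^sup>+z. (\<Prod>i\<in>UNIV. f i (z $ i)) \<partial>(lborel :: (real ^ 'm) measure)) = (\<Prod>i\<in>UNIV. \<integral>\<^sup>+x. f i x \<partial>lborel)"
proof -
  \<comment> \<open>Product integration over \<open>lborel\<close> is indexed by basis vectors;
    \<open>g\<close> carries the family \<open>f\<close> over to them. The description is unique
    because distinct indices have distinct unit vectors.\<close>
  define g where "g b = f (THE i. b = axis i (1::real))" for b :: "real ^ 'm"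
  have g: "g (axis i 1) = f i" for i
    unfolding g_def by (rule arg_cong[where f = f]) (auto simp: axis_eq_axis)
  have Basis: "(Basis :: (real ^ 'm) set) = (\<lambda>i. axis i 1) ` UNIV"
    by (auto simp: Basis_vec_def)
  have inj: "inj (\<lambda>i. axis i (1::real) :: real ^ 'm)"
    by (auto simp: inj_on_def axis_eq_axis)
  have "(\<integral>\<^sup>+z. (\<Prod>b\<in>Basis. g b (z \<bullet> b)) \<partial>(lborel :: (real ^ 'm) measure)) = (\<Prod>b\<in>Basis. \<integral>\<^sup>+x. g b x \<partial>lborel)"
    using assms g by (intro nn_integral_lborel_prod) (auto simp: Basis)
  then show ?thesis
    unfolding Basis using inj by (simp add: prod.reindex g inner_axis)
qed

lemma distr_PiM_density_vec:
  fixes f :: "'m::finite \<Rightarrow> real \<Rightarrow> ennreal"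
  assumes f[measurable]: "\<And>i. f i \<in> borel_measurable borel"
    and prob: "\<And>i. prob_space (density lborel (f i))"
  shows "distr (PiM UNIV (\<lambda>i. density lborel (f i))) borel (\<lambda>\<omega>. \<chi> i. \<omega> i) =
    density lborel (\<lambda>z. \<Prod>i\<in>UNIV. f i (z $ i))"
proof -
  let ?D = "density lborel (\<lambda>z. \<Prod>i\<in>UNIV. f i (z $ i)) :: (real ^ 'm) measure"
  let ?P = "PiM UNIV (\<lambda>i. density lborel (f i))"
  interpret product_prob_space "\<lambda>i. density lborel (f i)"
    using prob by (rule product_prob_spaceI)
  have sets_P: "sets ?P = sets (PiM UNIV (\<lambda>_. borel))"
    by (intro sets_PiM_cong) auto
  have [measurable]: "(\<lambda>z i. z $ i) \<in> measurable borel ?P"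
    unfolding measurable_cong_sets[OF refl sets_P] by (rule measurable_PiM_single') auto
  have [measurable]: "(\<lambda>\<omega>. \<chi> i. \<omega> i) \<in> borel_measurable ?P"
    unfolding measurable_cong_sets[OF sets_P refl] by (rule borel_measurable_vec_lambda) auto
  \<comment> \<open>The identity is proved in the reverse direction because \<open>PiM\<close> is
    characterised by its values on boxes; pushing forward along \<open>vec_lambda\<close> then
    recovers the claim.\<close>
  have "distr ?D ?P (\<lambda>z i. z $ i) = ?P"
  proof (rule PiM_eqI)
    fix A assume "\<And>i. i \<in> UNIV \<Longrightarrow> A i \<in> sets (density lborel (f i))"
    then have A[measurable]: "A i \<in> sets borel" for i by auto
    have "emeasure (distr ?D ?P (\<lambda>z i. z $ i)) (Pi\<^sub>E UNIV A) =
        emeasure ?D {z. \<forall>i. z $ i \<in> A i}"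
    proof (subst emeasure_distr)
      show "Pi\<^sub>E UNIV A \<in> sets ?P"
        by (rule sets_PiM_I_finite) auto
    qed (auto intro!: arg_cong2[where f = emeasure])
    also have "\<dots> = (\<integral>\<^sup>+z. (\<Prod>i\<in>UNIV. f i (z $ i)) * indicator {z. \<forall>i. z $ i \<in> A i} z \<partial>lborel)"
      by (rule emeasure_density) auto
    \<comment> \<open>The indicator of a box is the product of the indicators of its sides, so the
      integral separates into one-dimensional ones.\<close>
    also have "\<dots> = (\<integral>\<^sup>+z. (\<Prod>i\<in>UNIV. f i (z $ i) * indicator (A i) (z $ i)) \<partial>lborel)"
      by (intro nn_integral_cong) (auto simp: prod.distrib indicator_def prod_zero_iff)
    also have "\<dots> = (\<Prod>i\<in>UNIV. \<integral>\<^sup>+x. f i x * indicator (A i) x \<partial>lborel)"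
      by (rule nn_integral_lborel_prod_vec) measurable
    also have "\<dots> = (\<Prod>i\<in>UNIV. emeasure (density lborel (f i)) (A i))"
      by (simp add: emeasure_density)
    finally show "emeasure (distr ?D ?P (\<lambda>z i. z $ i)) (Pi\<^sub>E UNIV A) =
        (\<Prod>i\<in>UNIV. emeasure (density lborel (f i)) (A i))" .
  qed auto
  then have "distr ?P borel (\<lambda>\<omega>. \<chi> i. \<omega> i) = distr (distr ?D ?P (\<lambda>z i. z $ i)) borel (\<lambda>\<omega>. \<chi> i. \<omega> i)"
    by simp
  also have "\<dots> = distr ?D borel (\<lambda>z. z)"
    by (subst distr_distr) (auto simp: o_def)
  also have "\<dots> = ?D"
    by (rule distr_id2) simp
  finally show ?thesis .
qed

text \<open>The normal approximation is indexed by the number of trials, which in block i is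
  \<open>m n i\<close> rather than \<open>n\<close>; this index tends to infinity but need not be
  monotone.\<close>

lemma weak_conv_m_compose_filterlim:
  assumes "weak_conv_m M_seq M" "filterlim f at_top sequentially"
  shows "weak_conv_m (\<lambda>n. M_seq (f n)) M"
  using assms filterlim_compose unfolding weak_conv_m_def weak_conv_def by blast

lemma borel_measurable_vec_lambda_PiM [measurable]:
  "(vec_lambda :: ('m::finite \<Rightarrow> real) \<Rightarrow> real ^ 'm) \<in> borel_measurable (PiM UNIV (\<lambda>_. borel))"
  using borel_measurable_vec_lambda[of "\<lambda>i \<omega>. \<omega> i" "PiM (UNIV :: 'm set) (\<lambda>_. borel)"] by simp

text \<open>Under independence the joint law is the product of the marginals. Expectations of the
  original vector can therefore be computed on any space carrying independent coordinates with the
  same laws.\<close>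

lemma distr_vec_eqI_indep_vars:
  fixes X :: "'m::finite \<Rightarrow> 'a \<Rightarrow> real" and Y :: "'m \<Rightarrow> 'b \<Rightarrow> real"
  assumes M: "prob_space M" "prob_space.indep_vars M (\<lambda>_. borel) X UNIV"
    and N: "prob_space N" "prob_space.indep_vars N (\<lambda>_. borel) Y UNIV"
    and eq: "\<And>i. distr M borel (X i) = distr N borel (Y i)"
  shows "distr M borel (\<lambda>\<omega>. \<chi> i. X i \<omega>) = distr N borel (\<lambda>\<omega>. \<chi> i. Y i \<omega>)"
proof -
  interpret M: prob_space M by fact
  interpret N: prob_space N by fact
  have [measurable]: "X i \<in> borel_measurable M" "Y i \<in> borel_measurable N" for i
    using M(2) N(2) by (auto simp: M.indep_vars_def N.indep_vars_def)
  have "distr M (PiM UNIV (\<lambda>_. borel)) (\<lambda>\<omega>. \<lambda>i\<in>UNIV. X i \<omega>) =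
      distr N (PiM UNIV (\<lambda>_. borel)) (\<lambda>\<omega>. \<lambda>i\<in>UNIV. Y i \<omega>)"
    using M(2) N(2) eq by (simp add: M.indep_vars_iff_distr_eq_PiM' N.indep_vars_iff_distr_eq_PiM')
  then have "distr (distr M (PiM UNIV (\<lambda>_. borel)) (\<lambda>\<omega>. \<lambda>i\<in>UNIV. X i \<omega>)) borel (\<lambda>\<omega>. \<chi> i. \<omega> i) =
      distr (distr N (PiM UNIV (\<lambda>_. borel)) (\<lambda>\<omega>. \<lambda>i\<in>UNIV. Y i \<omega>)) borel (\<lambda>\<omega>. \<chi> i. \<omega> i)"
    by simp
  then show ?thesis
    by (simp add: distr_distr o_def) (simp add: restrict_UNIV)
qed

section \<open>Conditional expectations and half-space events\<close>

lemma integral_cond_law: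
  fixes Y :: "'w \<Rightarrow> 'a::topological_space" and f :: "'a \<Rightarrow> real"
  assumes "prob_space \<Omega>" and [measurable]: "A \<in> sets \<Omega>" "Y \<in> borel_measurable \<Omega>" "f \<in> borel_measurable borel"
    and A: "measure \<Omega> A \<noteq> 0"
  shows "integral\<^sup>L (cond_law \<Omega> A Y) f = (LINT \<omega>|\<Omega>. f (Y \<omega>) * indicator A \<omega>) / measure \<Omega> A"
proof -
  interpret prob_space \<Omega> by fact
  have pos: "0 < measure \<Omega> A" using A by (simp add: zero_less_measure_iff)
  have "integral\<^sup>L (cond_law \<Omega> A Y) f = (LINT \<omega>|uniform_measure \<Omega> A. f (Y \<omega>))"
    unfolding cond_law_def by (rule integral_distr) measurable
  \<comment> \<open>Positive probability makes the extended-real density the image of a real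
    function, the form needed for a Bochner integral against a density.\<close>
  also have "uniform_measure \<Omega> A = density \<Omega> (\<lambda>\<omega>. ennreal (indicator A \<omega> / measure \<Omega> A))"
    unfolding uniform_measure_def using pos divide_ennreal[of 1 "measure \<Omega> A"]
    by (intro density_cong) (auto simp: emeasure_eq_measure split: split_indicator)
  also have "(LINT \<omega>|\<dots>. f (Y \<omega>)) = (LINT \<omega>|\<Omega>. (f (Y \<omega>) * indicator A \<omega>) / measure \<Omega> A)"
    by (subst integral_real_density) (auto intro!: Bochner_Integration.integral_cong)
  also have "\<dots> = (LINT \<omega>|\<Omega>. f (Y \<omega>) * indicator A \<omega>) / measure \<Omega> A"
    by (rule integral_divide_zero)
  finally show ?thesis .
qed

text \<open>A real number strictly between \<open>K\<close> and \<open>w\<close> eventually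
  separates \<open>L n\<close> from \<open>v n\<close>, so the indicator is eventually constant. At
  \<open>K = w\<close> the order could oscillate.\<close>

lemma tendsto_indicator_le_sum:
  fixes v :: "nat \<Rightarrow> real" and L :: "nat \<Rightarrow> real"
  assumes "v \<longlonglongrightarrow> w" "(\<lambda>n. ereal (L n)) \<longlonglongrightarrow> K" "K \<noteq> ereal w"
  shows "(\<lambda>n. of_bool (L n \<le> v n) :: real) \<longlonglongrightarrow> of_bool (K \<le> ereal w)"
proof (cases "K < ereal w")
  case True
  then obtain c where c: "K < ereal c" "ereal c < ereal w" using ereal_dense2[OF True] by auto
  have "\<forall>\<^sub>F n in sequentially. ereal (L n) < ereal c" using assms(2) c(1) by (rule order_tendstoD)
  moreover have "\<forall>\<^sub>F n in sequentially. c < v n" using assms(1) c(2) by (intro order_tendstoD) auto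
  ultimately have "\<forall>\<^sub>F n in sequentially. of_bool (L n \<le> v n) = (of_bool (K \<le> ereal w) :: real)"
    by eventually_elim (use True in auto)
  then show ?thesis by (rule tendsto_eventually)
next
  case False
  then have K: "ereal w < K" using assms(3) by auto
  obtain c where c: "ereal w < ereal c" "ereal c < K" using ereal_dense2[OF K] by auto
  have "\<forall>\<^sub>F n in sequentially. ereal c < ereal (L n)" using assms(2) c(2) by (rule order_tendstoD)
  moreover have "\<forall>\<^sub>F n in sequentially. v n < c" using assms(1) c(1) by (intro order_tendstoD) auto
  ultimately have "\<forall>\<^sub>F n in sequentially. of_bool (L n \<le> v n) = (of_bool (K \<le> ereal w) :: real)"
    by eventually_elim (use K in auto)
  then show ?thesis by (rule tendsto_eventually)
qed

lemma expectation_half_space_tendsto: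
  fixes V :: "'a \<Rightarrow> real ^ 'm::finite" and f :: "real ^ 'm \<Rightarrow> real"
  assumes "prob_space P"
    and [measurable]: "\<And>n. Vs n \<in> borel_measurable P" "V \<in> borel_measurable P"
    and V: "\<And>\<omega>. \<omega> \<in> space P \<Longrightarrow> (\<lambda>n. Vs n \<omega>) \<longlonglongrightarrow> V \<omega>"
    and f: "continuous_on UNIV f" "bounded (range f)"
    and K: "(\<lambda>n. ereal (L n)) \<longlonglongrightarrow> K"
    and AE: "AE \<omega> in P. K \<noteq> ereal (\<Sum>i\<in>UNIV. V \<omega> $ i)"
  shows "(\<lambda>n. LINT \<omega>|P. f (Vs n \<omega>) * of_bool (L n \<le> (\<Sum>i\<in>UNIV. Vs n \<omega> $ i)))
    \<longlonglongrightarrow> (LINT \<omega>|P. f (V \<omega>) * of_bool (K \<le> ereal (\<Sum>i\<in>UNIV. V \<omega> $ i)))"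
proof -
  interpret prob_space P by fact
  obtain B where B: "\<And>z. \<bar>f z\<bar> \<le> B" using f(2) by (auto simp: bounded_iff)
  have [measurable]: "f \<in> borel_measurable borel" using f(1) by (rule borel_measurable_continuous_onI)
  show ?thesis
  proof (rule integral_dominated_convergence[where w = "\<lambda>_. B"])
    show "AE \<omega> in P. (\<lambda>n. f (Vs n \<omega>) * of_bool (L n \<le> (\<Sum>i\<in>UNIV. Vs n \<omega> $ i)))
        \<longlonglongrightarrow> f (V \<omega>) * of_bool (K \<le> ereal (\<Sum>i\<in>UNIV. V \<omega> $ i))"
      using AE AE_space
    proof eventually_elim
      case (elim \<omega>)
      have "(\<lambda>n. f (Vs n \<omega>)) \<longlonglongrightarrow> f (V \<omega>)"
        using f(1) V[OF elim(2)] by (rule continuous_on_tendsto_compose) auto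
      moreover have "(\<lambda>n. of_bool (L n \<le> (\<Sum>i\<in>UNIV. Vs n \<omega> $ i)) :: real)
          \<longlonglongrightarrow> of_bool (K \<le> ereal (\<Sum>i\<in>UNIV. V \<omega> $ i))"
        using elim(1) by (intro tendsto_indicator_le_sum K tendsto_sum tendsto_vec_nth V elim(2))
      ultimately show ?case by (rule tendsto_mult)
    qed
    show "AE \<omega> in P. norm (f (Vs n \<omega>) * of_bool (L n \<le> (\<Sum>i\<in>UNIV. Vs n \<omega> $ i))) \<le> B" for n
      \<comment> \<open>The second fact is 0 \<le> B, needed where the indicator vanishes.\<close>
      using B order_trans[OF abs_ge_zero B] by (auto simp: of_bool_def)
  qed auto
qed

section \<open>Pointwise convergent representation of independent coordinates\<close>

text \<open>Within one coordinate the coupling ties together all \<open>n\<close>; across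
  coordinates independence is required only for each fixed \<open>n\<close> and for the limit. A
  product of one-dimensional couplings provides both.\<close>

lemma Skorohod_indep_vec:
  fixes \<mu> :: "nat \<Rightarrow> 'm::finite \<Rightarrow> real measure" and \<nu> :: "'m \<Rightarrow> real measure"
  assumes \<mu>: "\<And>n i. real_distribution (\<mu> n i)" and \<nu>: "\<And>i. real_distribution (\<nu> i)"
    and conv: "\<And>i. weak_conv_m (\<lambda>n. \<mu> n i) (\<nu> i)"
  obtains P :: "('m \<Rightarrow> real) measure" and Y_seq Y
  where "prob_space P"
    and "\<And>n. prob_space.indep_vars P (\<lambda>_. borel) (Y_seq n) UNIV"
    and "prob_space.indep_vars P (\<lambda>_. borel) Y UNIV"
    and "\<And>n i. distr P borel (Y_seq n i) = \<mu> n i" "\<And>i. distr P borel (Y i) = \<nu> i"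
    and "\<And>i \<omega>. \<omega> \<in> space P \<Longrightarrow> (\<lambda>n. Y_seq n i \<omega>) \<longlonglongrightarrow> Y i \<omega>"
proof -
  \<comment> \<open>All Skorohod spaces have the common type \<open>real measure\<close>, so they
    can be chosen as one family in \<open>i\<close> and multiplied.\<close>
  have "\<forall>i. \<exists>Q Zs Z. prob_space (Q :: real measure) \<and> (\<forall>n. Zs n \<in> borel_measurable Q) \<and>
      (\<forall>n. distr Q borel (Zs n) = \<mu> n i) \<and> Z \<in> borel_measurable Q \<and> distr Q borel Z = \<nu> i \<and>
      (\<forall>x\<in>space Q. (\<lambda>n. Zs n x) \<longlonglongrightarrow> Z x)"
    using Skorohod[OF \<mu> \<nu> conv] by simp
  then obtain Q Zs Z where Q: "\<And>i. prob_space (Q i :: real measure)"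
    and [measurable]: "\<And>i n. Zs i n \<in> borel_measurable (Q i)" "\<And>i. Z i \<in> borel_measurable (Q i)"
    and Zs: "\<And>i n. distr (Q i) borel (Zs i n) = \<mu> n i" and Z: "\<And>i. distr (Q i) borel (Z i) = \<nu> i"
    and lim: "\<And>i x. x \<in> space (Q i) \<Longrightarrow> (\<lambda>n. Zs i n x) \<longlonglongrightarrow> Z i x"
    by metis
  define P where "P = PiM UNIV Q"
  interpret P: prob_space P unfolding P_def using Q by (rule prob_space_PiM)
  have ind: "P.indep_vars Q (\<lambda>i \<omega>. \<omega> i) UNIV"
    unfolding P_def using Q by (rule indep_vars_PiM_components)
  have distr: "distr P borel (\<lambda>\<omega>. g (\<omega> i)) = distr (Q i) borel g"
    if [measurable]: "g \<in> borel_measurable (Q i)" for g :: "real \<Rightarrow> real" and i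
  proof -
    have "distr (Q i) borel g = distr (distr P (Q i) (\<lambda>\<omega>. \<omega> i)) borel g"
      unfolding P_def using Q by (simp add: distr_PiM_component)
    then show ?thesis by (simp add: distr_distr o_def P_def)
  qed
  show thesis
  proof (rule that[of P "\<lambda>n i \<omega>. Zs i n (\<omega> i)" "\<lambda>i \<omega>. Z i (\<omega> i)"])
    show "P.indep_vars (\<lambda>_. borel) (\<lambda>i \<omega>. Zs i n (\<omega> i)) UNIV" for n
      by (rule P.indep_vars_compose2[OF ind]) measurable
    show "P.indep_vars (\<lambda>_. borel) (\<lambda>i \<omega>. Z i (\<omega> i)) UNIV"
      by (rule P.indep_vars_compose2[OF ind]) measurable
    show "distr P borel (\<lambda>\<omega>. Zs i n (\<omega> i)) = \<mu> n i" for i n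
      by (simp add: distr Zs)
    show "distr P borel (\<lambda>\<omega>. Z i (\<omega> i)) = \<nu> i" for i
      by (simp add: distr Z)
    show "(\<lambda>n. Zs i n (\<omega> i)) \<longlonglongrightarrow> Z i (\<omega> i)" if "\<omega> \<in> space P" for i \<omega>
      using that by (intro lim) (auto simp: P_def space_PiM)
  qed (rule P.prob_space_axioms)
qed

section \<open>Null hyperplanes and non-null half-spaces\<close>

lemma AE_lborel_sum_neq:
  "AE z in (lborel :: (real ^ 'm::finite) measure). (\<Sum>i\<in>UNIV. z $ i) \<noteq> c"
proof -
  \<comment> \<open>The level set is a hyperplane with normal vector (1, ..., 1), nonzero because
    the index type is inhabited.\<close>
  have "negligible {z :: real ^ 'm. (\<chi> i. 1) \<bullet> z = c}"
    by (rule negligible_hyperplane) (auto simp: vec_eq_iff)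
  then have "{z :: real ^ 'm. (\<Sum>i\<in>UNIV. z $ i) = c} \<in> null_sets lebesgue"
    by (simp add: negligible_iff_null_sets inner_vec_def)
  then have "{z :: real ^ 'm. (\<Sum>i\<in>UNIV. z $ i) = c} \<in> null_sets lborel"
    by (subst (asm) null_sets_completion_iff) auto
  then show ?thesis by (rule AE_I') auto
qed

lemma measurable_H [measurable]: "H K \<in> sets borel"
  unfolding H_def by measurable

text \<open>For a real c > K the open half-space above level c lies in \<open>H K\<close>, and a
  nonempty open set is not negligible.\<close>

lemma not_AE_lborel_notin_H:
  assumes "K \<noteq> \<infinity>"
  shows "\<not> (AE z in (lborel :: (real ^ 'm::finite) measure). z \<notin> H K)"
proof
  assume AE: "AE z in (lborel :: (real ^ 'm) measure). z \<notin> H K"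
  obtain c where c: "K < ereal c" using assms ereal_dense2[of K \<infinity>] by auto
  let ?U = "{z :: real ^ 'm. c < (\<Sum>i\<in>UNIV. z $ i)}"
  have U: "?U \<subseteq> H K" by (auto simp: H_def intro!: less_imp_le[OF less_trans[OF c]])
  have "open ?U" by (intro open_Collect_less continuous_intros)
  moreover have "(\<chi> i. \<bar>c\<bar> + 1) \<in> ?U"
  proof -
    have "c < 1 * (\<bar>c\<bar> + 1)" by simp
    also have "\<dots> \<le> real CARD('m) * (\<bar>c\<bar> + 1)" by (intro mult_right_mono) (auto simp: Suc_le_eq)
    finally show ?thesis by simp
  qed
  then have "?U \<noteq> {}" by blast
  ultimately have "\<not> negligible ?U" by (rule open_not_negligible)
  moreover have "AE z in lborel. z \<notin> ?U" using AE U by (elim eventually_mono) auto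
  then have "?U \<in> null_sets lborel" by (subst AE_iff_null_sets) auto
  then have "negligible ?U" by (simp add: negligible_iff_null_sets null_sets_completionI)
  ultimately show False by simp
qed

section \<open>The Gaussian density and the limit law\<close>

lemma distr_vec_indep_vars_density:
  fixes X :: "'m::finite \<Rightarrow> 'a \<Rightarrow> real"
  assumes "prob_space M" "prob_space.indep_vars M (\<lambda>_. borel) X UNIV"
    and [measurable]: "\<And>i. f i \<in> borel_measurable borel"
    and X: "\<And>i. distr M borel (X i) = density lborel (f i)"
  shows "distr M borel (\<lambda>\<omega>. \<chi> i. X i \<omega>) = density lborel (\<lambda>z. \<Prod>i\<in>UNIV. f i (z $ i))"
proof -
  interpret prob_space M by fact
  have [measurable]: "X i \<in> borel_measurable M" for i
    using assms(2) by (auto simp: indep_vars_def)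
  let ?P = "PiM UNIV (\<lambda>_::'m. borel) :: ('m \<Rightarrow> real) measure"
  have "distr M borel (\<lambda>\<omega>. \<chi> i. X i \<omega>) = distr (distr M ?P (\<lambda>\<omega>. \<lambda>i\<in>UNIV. X i \<omega>)) borel (\<lambda>\<omega>. \<chi> i. \<omega> i)"
    by (simp add: distr_distr o_def) (simp add: restrict_UNIV)
  also have "distr M ?P (\<lambda>\<omega>. \<lambda>i\<in>UNIV. X i \<omega>) = PiM UNIV (\<lambda>i. density lborel (f i))"
    using assms(2) X by (simp add: indep_vars_iff_distr_eq_PiM')
  also have "distr \<dots> borel (\<lambda>\<omega>. \<chi> i. \<omega> i) = density lborel (\<lambda>z. \<Prod>i\<in>UNIV. f i (z $ i))"
    by (rule distr_PiM_density_vec) (simp_all add: prob_space_distr flip: X)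
  finally show ?thesis .
qed

lemma distr_scaled_std_normal:
  fixes Y :: "'a \<Rightarrow> real"
  assumes "prob_space M" and [measurable]: "Y \<in> borel_measurable M"
    and "distr M borel Y = std_normal_distribution" and "0 < s"
  shows "distr M borel (\<lambda>\<omega>. Y \<omega> * s) = density lborel (normal_density 0 s)"
proof -
  interpret prob_space M by fact
  \<comment> \<open>The affine rule for normal variables is phrased through
    \<open>distributed\<close> with target \<open>lborel\<close>, which has the same measurable sets
    as \<open>borel\<close>.\<close>
  have "distr M lborel Y = distr M borel Y" by (intro distr_cong) auto
  then have "distributed M lborel Y (normal_density 0 1)"
    using assms(3) by (auto simp: distributed_def)
  then have "distributed M lborel (\<lambda>\<omega>. 0 + s * Y \<omega>) (normal_density (0 + s * 0) (\<bar>s\<bar> * 1))"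
    using \<open>0 < s\<close> by (intro normal_density_affine) auto
  then have "distr M lborel (\<lambda>\<omega>. Y \<omega> * s) = density lborel (normal_density 0 s)"
    using \<open>0 < s\<close> by (simp add: distributed_def mult.commute)
  moreover have "distr M lborel (\<lambda>\<omega>. Y \<omega> * s) = distr M borel (\<lambda>\<omega>. Y \<omega> * s)"
    by (intro distr_cong) auto
  ultimately show ?thesis by simp
qed

text \<open>Identifies \<open>h\<close>, up to a constant, as the joint density of independent
  centred normals with variances \<alpha> i * p i * (1 - p i).\<close>

lemma prod_normal_density_eq_h:
  fixes \<alpha> p :: "'m::finite \<Rightarrow> real"
  assumes "\<And>i. 0 < \<alpha> i" "\<And>i. 0 < p i \<and> p i < 1"
  shows "(\<Prod>i\<in>UNIV. normal_density 0 (sqrt (\<alpha> i * (p i * (1 - p i)))) (z $ i)) =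
    (\<Prod>i\<in>UNIV. 1 / sqrt (2 * pi * (\<alpha> i * (p i * (1 - p i))))) * h p \<alpha> z"
proof -
  have "0 \<le> \<alpha> i * (p i * (1 - p i))" for i
    using assms[of i] by simp
  then show ?thesis
    unfolding h_def prod.distrib[symmetric]
    by (intro prod.cong) (simp_all add: normal_density_def mult_ac)
qed

lemma measurable_h [measurable]: "h p \<alpha> \<in> borel_measurable borel"
  unfolding h_def by measurable

lemma h_pos: "0 < h p \<alpha> z"
  unfolding h_def by (intro prod_pos) auto

text \<open>Multiplied by the normal constants \<open>C\<close>, the function is a product of
  probability densities and has total mass 1.\<close>

lemma integrable_h:
  fixes \<alpha> p :: "'m::finite \<Rightarrow> real"
  assumes "\<And>i. 0 < \<alpha> i" "\<And>i. 0 < p i \<and> p i < 1"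
  shows "integrable lborel (h p \<alpha>)"
proof -
  let ?s = "\<lambda>i. sqrt (\<alpha> i * (p i * (1 - p i)))"
  define C where "C = (\<Prod>i\<in>UNIV. 1 / sqrt (2 * pi * (\<alpha> i * (p i * (1 - p i)))))"
  have s: "0 < \<alpha> i * (p i * (1 - p i))" for i
    using assms[of i] by simp
  have C: "0 < C" unfolding C_def using s by (intro prod_pos) simp
  have "(\<integral>\<^sup>+z. (\<Prod>i\<in>UNIV. ennreal (normal_density 0 (?s i) (z $ i))) \<partial>(lborel :: (real ^ 'm) measure)) =
      (\<Prod>i\<in>UNIV. \<integral>\<^sup>+x. ennreal (normal_density 0 (?s i) x) \<partial>lborel)"
    by (rule nn_integral_lborel_prod_vec) measurable
  also have "\<dots> = 1"
  proof (intro prod.neutral ballI)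
    fix i
    interpret prob_space "density lborel (normal_density 0 (?s i))"
      by (rule prob_space_normal_density) (use s in simp)
    show "(\<integral>\<^sup>+x. ennreal (normal_density 0 (?s i) x) \<partial>lborel) = 1"
      using emeasure_space_1 by (simp add: emeasure_density)
  qed
  finally have "(\<integral>\<^sup>+z. ennreal (C * h p \<alpha> z) \<partial>lborel) = 1"
    using prod_normal_density_eq_h[of \<alpha> p, OF assms] by (simp add: prod_ennreal C_def)
  then have "integrable lborel (\<lambda>z. C * h p \<alpha> z)"
    using C by (intro integrableI_nonneg) (auto simp: h_pos less_imp_le)
  then show ?thesis using C by simp
qed

lemma integrable_h_indicator_H:
  fixes \<alpha> p :: "'m::finite \<Rightarrow> real"
  assumes "\<And>i. 0 < \<alpha> i" "\<And>i. 0 < p i \<and> p i < 1"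
  shows "integrable lborel (\<lambda>z. h p \<alpha> z * indicator (H K) z)"
  by (rule integrable_real_mult_indicator) (auto intro: integrable_h[of \<alpha> p, OF assms])

text \<open>Since \<open>h\<close> is positive everywhere, a zero integral would make
  \<open>H K\<close> a null set.\<close>

lemma integral_h_indicator_H_pos:
  fixes \<alpha> p :: "'m::finite \<Rightarrow> real"
  assumes "\<And>i. 0 < \<alpha> i" "\<And>i. 0 < p i \<and> p i < 1" "K \<noteq> \<infinity>"
  shows "0 < (LINT z|lborel. h p \<alpha> z * indicator (H K) z)"
proof -
  have "(LINT z|lborel. h p \<alpha> z * indicator (H K) z) \<noteq> 0"
  proof
    assume "(LINT z|lborel. h p \<alpha> z * indicator (H K) z) = 0"
    then have "AE z in lborel. h p \<alpha> z * indicator (H K) z = 0"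
      by (subst (asm) integral_nonneg_eq_0_iff_AE[OF integrable_h_indicator_H[of \<alpha> p, OF assms(1,2)]])
        (auto simp: h_pos less_imp_le)
    then have "AE z in (lborel :: (real ^ 'm) measure). z \<notin> H K"
      by eventually_elim (use h_pos[of p \<alpha>] in \<open>auto simp: indicator_def split: if_splits\<close>, metis less_irrefl)
    then show False using not_AE_lborel_notin_H[OF assms(3)] by blast
  qed
  moreover have "0 \<le> (LINT z|lborel. h p \<alpha> z * indicator (H K) z)"
    by (intro integral_nonneg_AE) (auto simp: h_pos less_imp_le)
  ultimately show ?thesis by linarith
qed

lemma prob_space_limit_law:
  fixes \<alpha> p :: "'m::finite \<Rightarrow> real"
  assumes "\<And>i. 0 < \<alpha> i" "\<And>i. 0 < p i \<and> p i < 1" "K \<noteq> \<infinity>"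
  shows "prob_space (limit_law p \<alpha> K)"
proof
  let ?c = "LINT z|lborel. h p \<alpha> z * indicator (H K) z"
  have c: "0 < ?c" using assms by (rule integral_h_indicator_H_pos)
  have "emeasure (limit_law p \<alpha> K) (space (limit_law p \<alpha> K)) =
      (\<integral>\<^sup>+z. ennreal (h p \<alpha> z * indicator (H K) z / ?c) \<partial>lborel)"
    unfolding limit_law_def by (simp add: emeasure_density)
  also have "\<dots> = ennreal (LINT z|lborel. h p \<alpha> z * indicator (H K) z / ?c)"
    using c by (intro nn_integral_eq_integral integrable_divide integrable_h_indicator_H assms)
      (auto simp: h_pos less_imp_le)
  also have "\<dots> = 1" using c by simp
  finally show "emeasure (limit_law p \<alpha> K) (space (limit_law p \<alpha> K)) = 1" .
qed

lemma integral_limit_law: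
  fixes \<alpha> p :: "'m::finite \<Rightarrow> real" and f :: "real ^ 'm \<Rightarrow> real"
  assumes "\<And>i. 0 < \<alpha> i" "\<And>i. 0 < p i \<and> p i < 1" "K \<noteq> \<infinity>"
    and [measurable]: "f \<in> borel_measurable borel"
  shows "integral\<^sup>L (limit_law p \<alpha> K) f =
    (LINT z|lborel. h p \<alpha> z * (f z * indicator (H K) z)) / (LINT z|lborel. h p \<alpha> z * indicator (H K) z)"
proof -
  let ?c = "LINT z|lborel. h p \<alpha> z * indicator (H K) z"
  have c: "0 < ?c" using assms(1-3) by (rule integral_h_indicator_H_pos)
  have "integral\<^sup>L (limit_law p \<alpha> K) f = (LINT z|lborel. h p \<alpha> z * indicator (H K) z / ?c * f z)"
    unfolding limit_law_def using c by (intro integral_real_density) (auto simp: h_pos less_imp_le)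
  also have "\<dots> = (LINT z|lborel. h p \<alpha> z * (f z * indicator (H K) z) / ?c)"
    by (intro Bochner_Integration.integral_cong) (auto simp: field_simps)
  finally show ?thesis by simp
qed

section \<open>Convergence of the conditional laws\<close>

lemma integral_binomial_pmf:
  assumes "p \<in> {0..1}"
  shows "(LINT x|binomial_pmf n p. real x) = real n * p"
proof -
  \<comment> \<open>The binomial weights are Bernstein polynomials at \<open>p\<close>, whose first
    moment is known.\<close>
  have "(LINT x|binomial_pmf n p. real x) = (\<Sum>k\<le>n. real k * Bernstein n k p)"
    unfolding expectation_binomial_pmf'[OF assms] by (simp add: Bernstein_def mult_ac)
  then show ?thesis by simp
qed

theorem theorem1p6:
  fixes \<alpha> p :: "'m::finite \<Rightarrow> real"
    and a :: real
    and m :: "nat \<Rightarrow> 'm \<Rightarrow> nat"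
    and k :: "nat \<Rightarrow> nat"
    and \<Omega> :: "nat \<Rightarrow> 'w measure"
    and X :: "nat \<Rightarrow> 'm \<Rightarrow> 'w \<Rightarrow> nat"
    and K :: ereal
  assumes "\<And>i. 0 < \<alpha> i \<and> \<alpha> i < 1"
    and "(\<Sum>i\<in>UNIV. \<alpha> i) = 1"
    and "0 < a" and "a < 1"
    and "\<And>i. 0 < p i \<and> p i < 1"
    and "\<And>n. n \<ge> 1 \<Longrightarrow> (\<Sum>i\<in>UNIV. m n i) = n"
    and "\<And>i. (\<lambda>n. real (m n i) / real n) \<longlonglongrightarrow> \<alpha> i"
    and "\<And>n. n \<ge> 1 \<Longrightarrow> k n \<le> n"
    and "(\<lambda>n. real (k n) / real n) \<longlonglongrightarrow> a"
    and "\<And>n. n \<ge> 1 \<Longrightarrow> prob_space (\<Omega> n)"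
    and "\<And>n. n \<ge> 1 \<Longrightarrow> prob_space.indep_vars (\<Omega> n) (\<lambda>_. count_space UNIV) (X n) UNIV"
    and "\<And>n i. n \<ge> 1 \<Longrightarrow>
           distr (\<Omega> n) (count_space UNIV) (X n i) = measure_pmf (binomial_pmf (m n i) (p i))"
    and "K \<noteq> \<infinity>"
    and "(\<lambda>n. ereal ((real (k n) - (LINT \<omega>|\<Omega> n. real (\<Sum>i\<in>UNIV. X n i \<omega>))) / sqrt (real n)))
           \<longlonglongrightarrow> K"
  shows "prob_space (limit_law p \<alpha> K) \<and>
         weakly_converges
           (\<lambda>n. cond_law (\<Omega> n) {\<omega> \<in> space (\<Omega> n). k n \<le> (\<Sum>i\<in>UNIV. X n i \<omega>)}
                  (\<lambda>\<omega>. centred_scaled n p (m n) (\<lambda>i. X n i \<omega>)))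
           (limit_law p \<alpha> K)"
proof
  have \<alpha>: "0 < \<alpha> i" and p: "0 < p i" "p i < 1" for i
    using assms(1,5) by auto
  show "prob_space (limit_law p \<alpha> K)"
    using \<alpha> assms(5,13) by (rule prob_space_limit_law)
  \<comment> \<open>\<open>\<sigma> n i\<close> is the standard deviation of the count in block i,
    and \<open>s i\<close> its limit on the scale sqrt n.\<close>
  define s where "s i = sqrt (\<alpha> i * (p i * (1 - p i)))" for i
  define \<sigma> where "\<sigma> n i = sqrt (real (m n i) * (p i * (1 - p i)))" for n i
  have s: "0 < s i" for i
    using \<alpha>[of i] p[of i] by (simp add: s_def)
  have \<sigma>_s: "(\<lambda>n. \<sigma> n i / sqrt (real n)) \<longlonglongrightarrow> s i" for i
  proof -
    have "(\<lambda>n. sqrt (real (m n i) / real n * (p i * (1 - p i)))) \<longlonglongrightarrow> s i"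
      unfolding s_def by (intro tendsto_intros assms(7))
    then show ?thesis
      by (simp add: \<sigma>_def flip: real_sqrt_divide)
  qed
  \<comment> \<open>A positive limiting proportion forces the block size to infinity.\<close>
  have m_top: "filterlim (\<lambda>n. m n i) at_top sequentially" for i
  proof -
    have "filterlim (\<lambda>n. real (m n i) / real n * real n) at_top sequentially"
      using assms(7) \<alpha> by (rule filterlim_tendsto_pos_mult_at_top) (rule filterlim_real_sequentially)
    moreover have "\<forall>\<^sub>F n in sequentially. real (m n i) / real n * real n = real (m n i)"
      using eventually_gt_at_top[of 0] by eventually_elim simp
    ultimately have "filterlim (\<lambda>n. real (m n i)) at_top sequentially"
      by (simp cong: filterlim_cong)
    then show ?thesis by (simp add: filterlim_sequentially_iff_filterlim_real)
  qed

  define \<mu> where "\<mu> n i = distr (binomial_pmf (m n i) (p i)) borel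
      (\<lambda>x. (real x - p i * real (m n i)) / \<sigma> n i)" for n i
  have \<mu>: "real_distribution (\<mu> n i)" for n i
    unfolding \<mu>_def by (rule prob_space.real_distribution_distr[OF measure_pmf.prob_space_axioms]) simp
  have \<mu>_conv: "weak_conv_m (\<lambda>n. \<mu> n i) std_normal_distribution" for i
    unfolding \<mu>_def \<sigma>_def by (rule weak_conv_m_compose_filterlim[OF de_Moivre_Laplace m_top]) (use p in auto)
  obtain P :: "('m \<Rightarrow> real) measure" and Ys Y where P: "prob_space P"
    and indYs: "\<And>n. prob_space.indep_vars P (\<lambda>_. borel) (Ys n) UNIV"
    and indY: "prob_space.indep_vars P (\<lambda>_. borel) Y UNIV"
    and Ys: "\<And>n i. distr P borel (Ys n i) = \<mu> n i"
    and Y: "\<And>i. distr P borel (Y i) = std_normal_distribution"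
    and lim: "\<And>i \<omega>. \<omega> \<in> space P \<Longrightarrow> (\<lambda>n. Ys n i \<omega>) \<longlonglongrightarrow> Y i \<omega>"
    by (rule Skorohod_indep_vec[of \<mu> "\<lambda>_. std_normal_distribution", OF \<mu> real_dist_normal_dist \<mu>_conv]) (rule that)
  interpret P: prob_space P by fact
  have [measurable]: "Ys n i \<in> borel_measurable P" "Y i \<in> borel_measurable P" for n i
    using indYs[of n] indY by (auto simp: P.indep_vars_def)
  \<comment> \<open>The factor replaces the division by the standard deviation with a division by
    sqrt n, so \<open>Vs n\<close> has the law of the scaled vector once all blocks are
    nonempty.\<close>
  define Vs where "Vs n \<omega> = (\<chi> i. Ys n i \<omega> * (\<sigma> n i / sqrt (real n)))" for n \<omega>
  define V where "V \<omega> = (\<chi> i. Y i \<omega> * s i)" for \<omega>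
  have [measurable]: "Vs n \<in> borel_measurable P" "V \<in> borel_measurable P" for n
    unfolding Vs_def[abs_def] V_def[abs_def] by (intro borel_measurable_vec_lambda; measurable)+
  have V_lim: "(\<lambda>n. Vs n \<omega>) \<longlonglongrightarrow> V \<omega>" if "\<omega> \<in> space P" for \<omega>
    unfolding Vs_def V_def by (intro tendsto_vec_lambda tendsto_mult lim \<sigma>_s that)

  define C where "C = (\<Prod>i\<in>UNIV. 1 / sqrt (2 * pi * (\<alpha> i * (p i * (1 - p i)))))"
  have C: "0 < C"
    unfolding C_def using \<alpha> p by (intro prod_pos) simp
  have "distr P borel V = density lborel (\<lambda>z. \<Prod>i\<in>UNIV. ennreal (normal_density 0 (s i) (z $ i)))"
    unfolding V_def[abs_def]
  proof (rule distr_vec_indep_vars_density[OF P])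
    show "P.indep_vars (\<lambda>_. borel) (\<lambda>i \<omega>. Y i \<omega> * s i) UNIV"
      by (rule P.indep_vars_compose2[OF indY]) measurable
    show "distr P borel (\<lambda>\<omega>. Y i \<omega> * s i) = density lborel (normal_density 0 (s i))" for i
      by (rule distr_scaled_std_normal[OF P _ Y s]) measurable
  qed measurable
  then have V: "distr P borel V = density lborel (\<lambda>z. ennreal (C * h p \<alpha> z))"
    using prod_normal_density_eq_h[of \<alpha> p, OF \<alpha> assms(5)] by (simp add: prod_ennreal s_def C_def)

  \<comment> \<open>The threshold with the mean of the total count written out; it agrees with the
    sequence in the hypothesis for n \<ge> 1.\<close>
  define L where "L n = (real (k n) - (\<Sum>i\<in>UNIV. p i * real (m n i))) / sqrt (real n)" for n
  have rv: "X n i \<in> measurable (\<Omega> n) (count_space UNIV)" if "n \<ge> 1" for n i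
    using assms(11)[OF that] by (auto simp: prob_space.indep_vars_def[OF assms(10)[OF that]])
  have mean: "(LINT \<omega>|\<Omega> n. real (\<Sum>i\<in>UNIV. X n i \<omega>)) = (\<Sum>i\<in>UNIV. p i * real (m n i))"
    if n: "n \<ge> 1" for n
  proof -
    have [measurable]: "X n i \<in> measurable (\<Omega> n) (count_space UNIV)" for i
      by (rule rv[OF n])
    have "integrable (distr (\<Omega> n) (count_space UNIV) (X n i)) real" for i
      unfolding assms(12)[OF n] using p[of i] by (intro integrable_binomial_pmf) auto
    then have "integrable (\<Omega> n) (\<lambda>\<omega>. real (X n i \<omega>))" for i
      by (subst (asm) integrable_distr_eq) auto
    moreover have "(LINT \<omega>|\<Omega> n. real (X n i \<omega>)) = p i * real (m n i)" for i
    proof -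
      have "(LINT \<omega>|\<Omega> n. real (X n i \<omega>)) = integral\<^sup>L (distr (\<Omega> n) (count_space UNIV) (X n i)) real"
        by (rule integral_distr[symmetric]) auto
      then show ?thesis
        unfolding assms(12)[OF n] using p[of i] by (simp add: integral_binomial_pmf)
    qed
    ultimately show ?thesis
      by (simp add: Bochner_Integration.integral_sum)
  qed
  have "\<forall>\<^sub>F n in sequentially.
      ereal ((real (k n) - (LINT \<omega>|\<Omega> n. real (\<Sum>i\<in>UNIV. X n i \<omega>))) / sqrt (real n)) = ereal (L n)"
    using eventually_ge_at_top[of 1] by eventually_elim (simp only: mean L_def)
  then have L: "(\<lambda>n. ereal (L n)) \<longlonglongrightarrow> K"
    using assms(14) by (rule Lim_transform_eventually[rotated])

  \<comment> \<open>\<open>?E f\<close> is the numerator of the conditional expectation, and at the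
    constant function 1 its denominator; \<open>?I\<close> is the limit counterpart without the
    factor \<open>C\<close>.\<close>
  let ?E = "\<lambda>(f :: real ^ 'm \<Rightarrow> real) n. LINT \<omega>|P. f (Vs n \<omega>) * of_bool (L n \<le> (\<Sum>i\<in>UNIV. Vs n \<omega> $ i))"
  let ?I = "\<lambda>f :: real ^ 'm \<Rightarrow> real. LINT z|lborel. h p \<alpha> z * (f z * indicator (H K) z)"
  have E_lim: "?E f \<longlonglongrightarrow> C * ?I f" if f: "continuous_on UNIV f" "bounded (range f)" for f
  proof -
    have [measurable]: "f \<in> borel_measurable borel"
      using f(1) by (rule borel_measurable_continuous_onI)
    \<comment> \<open>If \<open>K\<close> equals the coordinate sum, then so does
      \<open>real_of_ereal K\<close>. For K = -\<infinity> equality is impossible, and the default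
      value 0 does no harm.\<close>
    have "AE z in lborel. K \<noteq> ereal (\<Sum>i\<in>UNIV. z $ i)"
      using AE_lborel_sum_neq[of "real_of_ereal K"] by eventually_elim auto
    then have "AE z in distr P borel V. K \<noteq> ereal (\<Sum>i\<in>UNIV. z $ i)"
      unfolding V by (subst AE_density) auto
    then have "AE \<omega> in P. K \<noteq> ereal (\<Sum>i\<in>UNIV. V \<omega> $ i)"
      by (subst (asm) AE_distr_iff) auto
    then have "?E f \<longlonglongrightarrow> (LINT \<omega>|P. f (V \<omega>) * of_bool (K \<le> ereal (\<Sum>i\<in>UNIV. V \<omega> $ i)))"
      using f L V_lim by (intro expectation_half_space_tendsto P) auto
    also have "(LINT \<omega>|P. f (V \<omega>) * of_bool (K \<le> ereal (\<Sum>i\<in>UNIV. V \<omega> $ i))) =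
        (LINT z|distr P borel V. f z * indicator (H K) z)"
      by (subst integral_distr) (auto simp: H_def indicator_def intro!: Bochner_Integration.integral_cong)
    also have "\<dots> = (LINT z|lborel. C * h p \<alpha> z * (f z * indicator (H K) z))"
      unfolding V using C by (intro integral_real_density) (auto simp: h_pos less_imp_le)
    also have "\<dots> = C * ?I f"
      by (simp add: mult.assoc)
    finally show ?thesis .
  qed

  have transfer: "(LINT \<omega>|\<Omega> n. f (centred_scaled n p (m n) (\<lambda>i. X n i \<omega>)) *
        indicator {\<omega> \<in> space (\<Omega> n). k n \<le> (\<Sum>i\<in>UNIV. X n i \<omega>)} \<omega>) = ?E f n"
    if n: "n \<ge> 1" and m: "\<And>i. m n i > 0" and [measurable]: "f \<in> borel_measurable borel"
    for n and f :: "real ^ 'm \<Rightarrow> real"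
  proof -
    interpret \<Omega>: prob_space "\<Omega> n" by (rule assms(10)[OF n])
    have [measurable]: "X n i \<in> measurable (\<Omega> n) (count_space UNIV)" for i
      by (rule rv[OF n])
    let ?g = "\<lambda>i x. (real x - p i * real (m n i)) / sqrt (real n)"
    let ?Z = "\<lambda>\<omega>. centred_scaled n p (m n) (\<lambda>i. X n i \<omega>)"
    \<comment> \<open>Nonempty blocks make the standard deviation nonzero, so standardising and
      rescaling cancel correctly.\<close>
    have \<sigma>: "\<sigma> n i \<noteq> 0" for i
      using m[of i] p[of i] by (simp add: \<sigma>_def)
    have distr: "distr (\<Omega> n) borel ?Z = distr P borel (Vs n)"
      unfolding centred_scaled_def Vs_def[abs_def]
    proof (rule distr_vec_eqI_indep_vars[OF \<Omega>.prob_space_axioms _ P])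
      show "\<Omega>.indep_vars (\<lambda>_. borel) (\<lambda>i \<omega>. ?g i (X n i \<omega>)) UNIV"
        by (rule \<Omega>.indep_vars_compose2[OF assms(11)[OF n]]) measurable
      show "P.indep_vars (\<lambda>_. borel) (\<lambda>i \<omega>. Ys n i \<omega> * (\<sigma> n i / sqrt (real n))) UNIV"
        by (rule P.indep_vars_compose2[OF indYs]) measurable
      fix i
      have "distr (\<Omega> n) borel (\<lambda>\<omega>. ?g i (X n i \<omega>)) = distr (distr (\<Omega> n) (count_space UNIV) (X n i)) borel (?g i)"
        by (simp add: distr_distr o_def)
      also have "\<dots> = distr (binomial_pmf (m n i) (p i)) borel (?g i)"
        unfolding assms(12)[OF n] ..
      also have "\<dots> = distr (\<mu> n i) borel (\<lambda>y. y * (\<sigma> n i / sqrt (real n)))"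
        unfolding \<mu>_def using \<sigma>[of i] by (simp add: distr_distr o_def)
      also have "\<dots> = distr P borel (\<lambda>\<omega>. Ys n i \<omega> * (\<sigma> n i / sqrt (real n)))"
        by (simp add: distr_distr o_def flip: Ys)
      finally show "distr (\<Omega> n) borel (\<lambda>\<omega>. ?g i (X n i \<omega>)) =
          distr P borel (\<lambda>\<omega>. Ys n i \<omega> * (\<sigma> n i / sqrt (real n)))" .
    qed
    have [measurable]: "?Z \<in> borel_measurable (\<Omega> n)"
      unfolding centred_scaled_def by (rule borel_measurable_vec_lambda) measurable
    \<comment> \<open>The event becomes a condition on the scaled vector alone, so the expectation
      depends only on its law and can be moved to \<open>P\<close>.\<close>
    have event: "k n \<le> (\<Sum>i\<in>UNIV. X n i \<omega>) \<longleftrightarrow> L n \<le> (\<Sum>i\<in>UNIV. ?Z \<omega> $ i)" for \<omega>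
    proof -
      have "(\<Sum>i\<in>UNIV. ?Z \<omega> $ i) = (real (\<Sum>i\<in>UNIV. X n i \<omega>) - (\<Sum>i\<in>UNIV. p i * real (m n i))) / sqrt (real n)"
        by (simp add: centred_scaled_def sum_subtractf flip: sum_divide_distrib)
      then have "L n \<le> (\<Sum>i\<in>UNIV. ?Z \<omega> $ i) \<longleftrightarrow> real (k n) \<le> real (\<Sum>i\<in>UNIV. X n i \<omega>)"
        using n by (simp add: L_def divide_le_cancel del: of_nat_sum)
      then show ?thesis by (simp del: of_nat_sum)
    qed
    have "(LINT \<omega>|\<Omega> n. f (?Z \<omega>) * indicator {\<omega> \<in> space (\<Omega> n). k n \<le> (\<Sum>i\<in>UNIV. X n i \<omega>)} \<omega>) =
        (LINT \<omega>|\<Omega> n. f (?Z \<omega>) * of_bool (L n \<le> (\<Sum>i\<in>UNIV. ?Z \<omega> $ i)))"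
      by (intro Bochner_Integration.integral_cong) (auto simp: event)
    also have "\<dots> = (LINT z|distr (\<Omega> n) borel ?Z. f z * of_bool (L n \<le> (\<Sum>i\<in>UNIV. z $ i)))"
      by (rule integral_distr[symmetric]) measurable
    also have "\<dots> = ?E f n"
      unfolding distr by (rule integral_distr) measurable
    finally show ?thesis .
  qed

  have c: "0 < ?I (\<lambda>_. 1)"
    using integral_h_indicator_H_pos[of \<alpha> p, OF \<alpha> assms(5,13)] by simp
  have E1_lim: "?E (\<lambda>_. 1) \<longlonglongrightarrow> C * ?I (\<lambda>_. 1)"
    by (rule E_lim) auto
  have m_pos: "\<forall>\<^sub>F n in sequentially. \<forall>i. 0 < m n i"
    by (intro eventually_all_finite eventually_compose_filterlim[OF eventually_gt_at_top m_top])

  show "weakly_converges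
           (\<lambda>n. cond_law (\<Omega> n) {\<omega> \<in> space (\<Omega> n). k n \<le> (\<Sum>i\<in>UNIV. X n i \<omega>)}
                  (\<lambda>\<omega>. centred_scaled n p (m n) (\<lambda>i. X n i \<omega>)))
           (limit_law p \<alpha> K)" (is "weakly_converges (\<lambda>n. cond_law (\<Omega> n) (?A n) (?Z n)) _")
    unfolding weakly_converges_def
  proof (intro allI impI, elim conjE)
    fix f :: "real ^ 'm \<Rightarrow> real"
    assume f: "continuous_on UNIV f" "bounded (range f)"
    have [measurable]: "f \<in> borel_measurable borel"
      using f(1) by (rule borel_measurable_continuous_onI)
    have "(\<lambda>n. ?E f n / ?E (\<lambda>_. 1) n) \<longlonglongrightarrow> C * ?I f / (C * ?I (\<lambda>_. 1))"
      using C c by (intro tendsto_divide E_lim E1_lim f) auto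
    also have "C * ?I f / (C * ?I (\<lambda>_. 1)) = integral\<^sup>L (limit_law p \<alpha> K) f"
      using C integral_limit_law[of \<alpha> p, OF \<alpha> assms(5,13), of f] by simp
    finally have ratio: "(\<lambda>n. ?E f n / ?E (\<lambda>_. 1) n) \<longlonglongrightarrow> integral\<^sup>L (limit_law p \<alpha> K) f" .
    \<comment> \<open>The limit of the denominator is positive, so the event eventually has nonzero
      probability; only from then on is the quotient identified with the conditional
      expectation.\<close>
    have "\<forall>\<^sub>F n in sequentially. 0 < ?E (\<lambda>_. 1) n"
      by (rule order_tendstoD(1)[OF E1_lim]) (use C c in \<open>rule mult_pos_pos\<close>)
    then have "\<forall>\<^sub>F n in sequentially. ?E f n / ?E (\<lambda>_. 1) n = integral\<^sup>L (cond_law (\<Omega> n) (?A n) (?Z n)) f"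
      using m_pos eventually_ge_at_top[of 1]
    proof eventually_elim
      case (elim n)
      interpret \<Omega>: prob_space "\<Omega> n" by (rule assms(10)) fact
      have [measurable]: "X n i \<in> measurable (\<Omega> n) (count_space UNIV)" for i
        by (rule rv) fact
      have [measurable]: "?Z n \<in> borel_measurable (\<Omega> n)"
        unfolding centred_scaled_def by (rule borel_measurable_vec_lambda) measurable
      have "measure (\<Omega> n) (?A n) = ?E (\<lambda>_. 1) n"
        using transfer[of n "\<lambda>_. 1"] elim by simp
      then show ?case
        using elim transfer[of n f] by (subst integral_cond_law) (auto intro: \<Omega>.prob_space_axioms)
    qed
    then show "(\<lambda>n. integral\<^sup>L (cond_law (\<Omega> n) (?A n) (?Z n)) f) \<longlonglongrightarrow> integral\<^sup>L (limit_law p \<alpha> K) f"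
      by (rule Lim_transform_eventually[OF ratio])
  qed
qed

end
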